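(* (Commutativity of duality and random-cluster transformation.) Let $\Lambda\subset\mathbb{Z}^2$ be bounded and simply connected, and let $J=(J_\sigma,J_\tau,J_{\sigma\tau})$ and $J^*=(J_\sigma^*,J_\tau^*,J_{\sigma\tau}^* )$ be elements of $\mathcal{D}=\{(x,y,z)\in\mathbb{R}^3: x\ge y\ge z,\ y>0,\ \tanh z>-\tanh x\tanh y\}$ related by the Ashkin–Teller duality relations $$\frac{s^*+t^*l^*}{1+s^*t^*l^*}=e^{-2(J_\tau+J_{\sigma\tau})},\quad \frac{t^*+s^*l^*}{1+s^*t^*l^*}=e^{-2(J_\sigma+J_{\sigma\tau})},\quad \frac{l^*+s^*t^*}{1+s^*t^*l^*}=e^{-2(J_\sigma+J_\tau)},$$ where $s^*=\tanh J_\sigma^*$, $t^*=\tanh J_\tau^*$, $l^*=\tanh J_{\sigma\tau}^*$. Then the dual of the generalized random-cluster model associated with the Ashkin–Teller model on $\Lambda$ with couplings $J$ and $(+,+)$-boundary condition coincides with the generalized random-cluster model associated with the dual Ashkin–Teller model, on $\Lambda^*$ with couplings $J^*$ and free boundary condition. That is, both are defined on the same set of bonds, $$\{\hat b: b\in\mathcal{B}^+(\Lambda)\}=\mathcal{B}(\Lambda^* ),$$ and they have the same parameters (both with cluster weights $q_\sigma=q_\tau=2$): $$\hat a_0(J)=a_0(J^* ),\quad \hat a_\sigma(J)=a_\sigma(J^* ),\quad \hat a_\tau(J)=a_\tau(J^* ),\quad \hat a_{\sigma\tau}(J)=a_{\sigma\tau}(J^* ).$$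
   Context: **Lattices.** Bonds are unit segments joining nearest neighbours of $\mathbb{Z}^2$; the dual lattice is $\mathbb{Z}^2+(\tfrac12,\tfrac12)$; $\hat b$ is the unique dual bond crossing the bond $b$; $p^*(t)$ is the closed dual plaquette centred at $t\in\mathbb{Z}^2$. $\Lambda$ is simply connected if $\bigcup_{t\in\Lambda}p^*(t)$ is simply connected in $\mathbb{R}^2$. $\mathcal{B}^+(\Lambda)$ is the set of bonds with at least one endpoint in $\Lambda$. $\Lambda^*$ is the cell complex formed by the plaquettes $p^*(t)$, $t\in\Lambda$, together with the set $\mathcal{B}(\Lambda^* )$ of dual bonds on their boundaries and the endpoints of these bonds. **Random-cluster parameters of the Ashkin–Teller model.** The generalized random-cluster (GRC) model associated with couplings $(J_\sigma,J_\tau,J_{\sigma\tau})$ has $q_\sigma=q_\tau=2$ and bond probabilities (for the bond states $(0,0),(1,0),(0,1),(1,1)$ respectively) $$a_0=e^{-2(J_\sigma+J_\tau)},\quad a_\sigma=e^{-2J_\tau}(e^{-2J_{\sigma\tau}}-e^{-2J_\sigma}),\quad a_\tau=e^{-2J_\sigma}(e^{-2J_{\sigma\tau}}-e^{-2J_\tau}),\quad a_{\sigma\tau}=1-a_0-a_\sigma-a_\tau .$$ With $(+,+)$-boundary condition on $\Lambda$ its non-fixed bonds are those of $\mathcal{B}^+(\Lambda)$; with free boundary condition on $\Lambda^*$ its non-fixed bonds are those of $\mathcal{B}(\Lambda^* )$. **Dual of a GRC model.** The dual of a GRC model with parameters $a_0,a_\sigma,a_\tau,a_{\sigma\tau},q_\sigma,q_\tau$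 and $(+,+)$-boundary condition on $\Lambda$ is the GRC model with free boundary condition on the dual bonds $\{\hat b:b\in\mathcal{B}^+(\Lambda)\}$ with $\hat q_\sigma=q_\tau$, $\hat q_\tau=q_\sigma$ and $$\hat a_0=C'a_{\sigma\tau},\quad \hat a_\sigma=q_\tau C'a_\sigma,\quad \hat a_\tau=q_\sigma C'a_\tau,\quad \hat a_{\sigma\tau}=q_\sigma q_\tau C'a_0,\qquad C'^{-1}=a_{\sigma\tau}+q_\tau a_\sigma+q_\sigma a_\tau+q_\sigma q_\tau a_0 .$$ In the claim, $a_\bullet(J)$ denotes the parameters computed from couplings $J$, and $\hat a_\bullet(J)$ the dual parameters computed from $a_\bullet(J)$ with $q_\sigma=q_\tau=2$. *)

theory Defs
  imports "HOL-Analysis.Analysis"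
begin

text \<open>Lattice geometry. Lattice points are points of the Euclidean plane \<^typ>\<open>real \<times> real\<close>, and
  bonds and plaquettes are the actual closed segments and squares.\<close>

definition square_lattice :: "(real \<times> real) set" where
  "square_lattice = \<int> \<times> \<int>"

definition dual_lattice :: "(real \<times> real) set" where
  "dual_lattice = (\<lambda>x. x + (1/2, 1/2)) ` square_lattice"

definition lattice_bonds :: "(real \<times> real) set \<Rightarrow> (real \<times> real) set set" where
  "lattice_bonds L = {closed_segment x y | x y. x \<in> L \<and> y \<in> L \<and> dist x y = 1}"

definition bonds :: "(real \<times> real) set set" where
  "bonds = lattice_bonds square_lattice"

definition dual_bonds :: "(real \<times> real) set set" where
  "dual_bonds = lattice_bonds dual_lattice"

definition bond_endpoints :: "(real \<times> real) set \<Rightarrow> (real \<times> real) set" where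
  "bond_endpoints b = {x. \<exists>y. b = closed_segment x y}"

text \<open>A bond and a dual bond cross iff they meet: since they are unit segments of lattices shifted by
  half a unit in both directions, they can only meet at their common midpoint.\<close>

definition dual_bond :: "(real \<times> real) set \<Rightarrow> (real \<times> real) set" where
  "dual_bond b = (THE e. e \<in> dual_bonds \<and> e \<inter> b \<noteq> {})"

definition dual_plaquette :: "real \<times> real \<Rightarrow> (real \<times> real) set" where
  "dual_plaquette t = cbox (t - (1/2, 1/2)) (t + (1/2, 1/2))"

definition lattice_simply_connected :: "(real \<times> real) set \<Rightarrow> bool" where
  "lattice_simply_connected \<Lambda> \<longleftrightarrow> simply_connected (\<Union>t\<in>\<Lambda>. dual_plaquette t)"

definition bonds_plus :: "(real \<times> real) set \<Rightarrow> (real \<times> real) set set" where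
  "bonds_plus \<Lambda> = {b \<in> bonds. bond_endpoints b \<inter> \<Lambda> \<noteq> {}}"

record cell_complex =
  complex_plaquettes :: "(real \<times> real) set set"
  complex_bonds :: "(real \<times> real) set set"
  complex_vertices :: "(real \<times> real) set"

definition dual_complex_bonds :: "(real \<times> real) set \<Rightarrow> (real \<times> real) set set" where
  "dual_complex_bonds \<Lambda> = {e \<in> dual_bonds. \<exists>t\<in>\<Lambda>. e \<subseteq> frontier (dual_plaquette t)}"

definition dual_complex :: "(real \<times> real) set \<Rightarrow> cell_complex" where
  "dual_complex \<Lambda> =
    \<lparr> complex_plaquettes = dual_plaquette ` \<Lambda>,
      complex_bonds = dual_complex_bonds \<Lambda>,
      complex_vertices = (\<Union>e\<in>dual_complex_bonds \<Lambda>. bond_endpoints e) \<rparr>"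

text \<open>Generalized random-cluster models. A model is determined by its boundary condition, its set of
  non-fixed bonds, the probabilities of the bond states (0,0), (1,0), (0,1), (1,1), and the two
  cluster weights.\<close>

record grc_params =
  a_0 :: real
  a_sigma :: real
  a_tau :: real
  a_sigmatau :: real
  q_sigma :: real
  q_tau :: real

datatype boundary_condition = Plus_Plus | Free

record grc_model =
  grc_boundary :: boundary_condition
  grc_bonds :: "(real \<times> real) set set"
  grc_par :: grc_params

definition grc_plus :: "(real \<times> real) set \<Rightarrow> grc_params \<Rightarrow> grc_model" where
  "grc_plus \<Lambda> P = \<lparr> grc_boundary = Plus_Plus, grc_bonds = bonds_plus \<Lambda>, grc_par = P \<rparr>"

definition grc_free :: "(real \<times> real) set set \<Rightarrow> grc_params \<Rightarrow> grc_model" where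
  "grc_free E P = \<lparr> grc_boundary = Free, grc_bonds = E, grc_par = P \<rparr>"

definition dual_params :: "grc_params \<Rightarrow> grc_params" where
  "dual_params P =
    (let C = inverse (a_sigmatau P + q_tau P * a_sigma P + q_sigma P * a_tau P
                      + q_sigma P * q_tau P * a_0 P)
     in \<lparr> a_0 = C * a_sigmatau P,
          a_sigma = q_tau P * C * a_sigma P,
          a_tau = q_sigma P * C * a_tau P,
          a_sigmatau = q_sigma P * q_tau P * C * a_0 P,
          q_sigma = q_tau P,
          q_tau = q_sigma P \<rparr>)"

text \<open>Only meaningful for models with (+,+)-boundary condition.\<close>

definition dual_grc :: "grc_model \<Rightarrow> grc_model" where
  "dual_grc M = grc_free (dual_bond ` grc_bonds M) (dual_params (grc_par M))"

text \<open>The Ashkin-Teller model: a triple of couplings is ordered as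
  \<open>(J\<^sub>\<sigma>, J\<^sub>\<tau>, J\<^sub>\<sigma>\<^sub>\<tau>)\<close>.\<close>

definition at_domain :: "(real \<times> real \<times> real) set" where
  "at_domain = {(x, y, z). x \<ge> y \<and> y \<ge> z \<and> y > 0 \<and> tanh z > - (tanh x * tanh y)}"

fun at_dual :: "real \<times> real \<times> real \<Rightarrow> real \<times> real \<times> real \<Rightarrow> bool" where
  "at_dual (J\<sigma>, J\<tau>, J\<sigma>\<tau>) (J\<sigma>', J\<tau>', J\<sigma>\<tau>') =
    (let s = tanh J\<sigma>'; t = tanh J\<tau>'; l = tanh J\<sigma>\<tau>'
     in (s + t * l) / (1 + s * t * l) = exp (- 2 * (J\<tau> + J\<sigma>\<tau>)) \<and>
        (t + s * l) / (1 + s * t * l) = exp (- 2 * (J\<sigma> + J\<sigma>\<tau>)) \<and>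
        (l + s * t) / (1 + s * t * l) = exp (- 2 * (J\<sigma> + J\<tau>)))"

fun at_params :: "real \<times> real \<times> real \<Rightarrow> grc_params" where
  "at_params (J\<sigma>, J\<tau>, J\<sigma>\<tau>) =
    (let a0 = exp (- 2 * (J\<sigma> + J\<tau>));
         a\<sigma> = exp (- 2 * J\<tau>) * (exp (- 2 * J\<sigma>\<tau>) - exp (- 2 * J\<sigma>));
         a\<tau> = exp (- 2 * J\<sigma>) * (exp (- 2 * J\<sigma>\<tau>) - exp (- 2 * J\<tau>))
     in \<lparr> a_0 = a0, a_sigma = a\<sigma>, a_tau = a\<tau>, a_sigmatau = 1 - a0 - a\<sigma> - a\<tau>,
          q_sigma = 2, q_tau = 2 \<rparr>)"

definition at_grc_plus :: "(real \<times> real) set \<Rightarrow> real \<times> real \<times> real \<Rightarrow> grc_model" where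
  "at_grc_plus \<Lambda> J = grc_plus \<Lambda> (at_params J)"

definition at_grc_free :: "cell_complex \<Rightarrow> real \<times> real \<times> real \<Rightarrow> grc_model" where
  "at_grc_free K J = grc_free (complex_bonds K) (at_params J)"

end

theory Submission
  imports Defs
begin

text \<open>The parameter identities become rational in \<open>X = exp (-2 J\<^sub>\<sigma>')\<close>, \<open>Y = exp (-2 J\<^sub>\<tau>')\<close>,
  \<open>Z = exp (-2 J\<^sub>\<sigma>\<^sub>\<tau>')\<close>: with \<open>D = 1 + XY + XZ + YZ\<close> the duality relations express the
  three pairwise products of exponentials of \<open>J\<close> as \<open>(1 + YZ - XY - XZ) / D\<close> and its permutations,
  and the normalising constant of the dual model is \<open>D / 4\<close>. The bond sets agree
  because the dual bonds crossing the four bonds at a site \<open>t\<close> are the four sides of the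
  plaquette centred at \<open>t\<close>.\<close>

subsection \<open>Parameters\<close>

text \<open>Writing each \<open>tanh u\<close> as \<open>(1 - U) / (1 + U)\<close> with
  \<open>U = exp (- 2 * u)\<close> puts numerator and denominator over the same \<open>P\<close>,
  and the common factor \<open>2 / P\<close> cancels.\<close>

lemma tanh_duality_ratio:
  fixes x y z :: real
  defines "X \<equiv> exp (- 2 * x)" and "Y \<equiv> exp (- 2 * y)" and "Z \<equiv> exp (- 2 * z)"
  shows "(tanh x + tanh y * tanh z) / (1 + tanh x * tanh y * tanh z)
    = (1 + Y * Z - X * Y - X * Z) / (1 + X * Y + X * Z + Y * Z)"
proof -
  have pos: "X > 0" "Y > 0" "Z > 0"
    by (simp_all add: X_def Y_def Z_def)
  define P where "P = (1 + X) * (1 + Y) * (1 + Z)"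
  have nz: "1 + X \<noteq> 0" "1 + Y \<noteq> 0" "1 + Z \<noteq> 0"
    using pos by linarith+
  have P: "P \<noteq> 0"
    using nz by (simp add: P_def)
  have t: "tanh x = (1 - X) / (1 + X)" "tanh y = (1 - Y) / (1 + Y)" "tanh z = (1 - Z) / (1 + Z)"
    unfolding X_def Y_def Z_def by (rule tanh_real_altdef)+
  have num: "tanh x + tanh y * tanh z = 2 * (1 + Y * Z - X * Y - X * Z) / P"
    unfolding t P_def using nz by (simp add: divide_simps) (simp add: algebra_simps)
  have den: "1 + tanh x * tanh y * tanh z = 2 * (1 + X * Y + X * Z + Y * Z) / P"
    unfolding t P_def using nz by (simp add: divide_simps) (simp add: algebra_simps)
  \<comment> \<open>For \<open>v = 0\<close> both sides are 0, so only \<open>P \<noteq> 0\<close>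
    matters.\<close>
  have "(2 * u / P) / (2 * v / P) = u / v" for u v
    using P by simp
  then show ?thesis
    unfolding num den .
qed

text \<open>The couplings \<open>J\<close> never have to be solved for: every parameter of
  \<open>J\<close> is affine in the pairwise products \<open>A * B\<close>, \<open>A * C\<close>,
  \<open>B * C\<close>, and these are what the duality relations supply.\<close>

lemma dual_params_at_params:
  assumes "at_dual J J'"
  shows "dual_params (at_params J) = at_params J'"
proof -
  obtain a b c where J: "J = (a, b, c)" by (cases J)
  obtain x y z where J': "J' = (x, y, z)" by (cases J')
  define A B C where "A = exp (- 2 * a)" and "B = exp (- 2 * b)" and "C = exp (- 2 * c)"
  define X Y Z where "X = exp (- 2 * x)" and "Y = exp (- 2 * y)" and "Z = exp (- 2 * z)"
  define D where "D = 1 + X * Y + X * Z + Y * Z"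
  have "X > 0" "Y > 0" "Z > 0"
    by (simp_all add: X_def Y_def Z_def)
  then have D: "D > 0"
    by (simp add: D_def add_pos_pos)
  have prods: "exp (- 2 * (b + c)) = B * C" "exp (- 2 * (a + c)) = A * C"
    "exp (- 2 * (a + b)) = A * B" "exp (- 2 * (x + y)) = X * Y"
    by (simp_all add: A_def B_def C_def X_def Y_def mult_exp_exp algebra_simps)
  \<comment> \<open>In each of the three uses of \<open>tanh_duality_ratio\<close>, the first
    argument is the dual coupling whose tanh stands alone in the numerator of the relation.\<close>
  have BC: "B * C = (1 + Y * Z - X * Y - X * Z) / D"
    using assms tanh_duality_ratio[of x y z]
    by (simp add: J J' Let_def prods[symmetric] D_def X_def Y_def Z_def algebra_simps)
  have AC: "A * C = (1 + X * Z - X * Y - Y * Z) / D"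
    using assms tanh_duality_ratio[of y x z]
    by (simp add: J J' Let_def prods[symmetric] D_def X_def Y_def Z_def algebra_simps)
  have AB: "A * B = (1 + X * Y - X * Z - Y * Z) / D"
    using assms tanh_duality_ratio[of z x y]
    by (simp add: J J' Let_def prods[symmetric] D_def X_def Y_def Z_def algebra_simps)
  have P: "at_params J = \<lparr> a_0 = A * B, a_sigma = B * C - A * B, a_tau = A * C - A * B,
      a_sigmatau = 1 + A * B - B * C - A * C, q_sigma = 2, q_tau = 2 \<rparr>"
    unfolding J at_params.simps Let_def prods A_def[symmetric] B_def[symmetric] C_def[symmetric]
    by (simp add: algebra_simps)
  have P': "at_params J' = \<lparr> a_0 = X * Y, a_sigma = Y * Z - X * Y, a_tau = X * Z - X * Y,
      a_sigmatau = 1 + X * Y - X * Z - Y * Z, q_sigma = 2, q_tau = 2 \<rparr>"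
    unfolding J' at_params.simps Let_def prods X_def[symmetric] Y_def[symmetric] Z_def[symmetric]
    by (simp add: algebra_simps)
  \<comment> \<open>With \<open>q = 2\<close> the inverse of the normalising constant collapses to
    this symmetric sum. The three numerators add up to \<open>4 - D\<close>, hence the value
    \<open>4 / D\<close>.\<close>
  have "1 + A * B + A * C + B * C
      = (D + (1 + X * Y - X * Z - Y * Z) + (1 + X * Z - X * Y - Y * Z) + (1 + Y * Z - X * Y - X * Z)) / D"
    unfolding AB AC BC
    by (simp only: add_divide_distrib divide_self[OF less_imp_neq[OF D, symmetric]])
  also have "\<dots> = 4 / D"
    by (simp add: D_def)
  finally have norm: "inverse (1 + A * B - B * C - A * C + 2 * (B * C - A * B) + 2 * (A * C - A * B)
      + 2 * 2 * (A * B)) = D / 4"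
    by (simp add: algebra_simps)
  have "1 + A * B - B * C - A * C
      = (D + (1 + X * Y - X * Z - Y * Z) - (1 + Y * Z - X * Y - X * Z) - (1 + X * Z - X * Y - Y * Z)) / D"
    unfolding AB AC BC
    by (simp only: add_divide_distrib diff_divide_distrib divide_self[OF less_imp_neq[OF D, symmetric]])
  also have "\<dots> = 4 * (X * Y) / D"
    by (simp add: D_def)
  finally have "D / 4 * (1 + A * B - B * C - A * C) = X * Y"
    using D by simp
  moreover have "2 * (D / 4) * (B * C - A * B) = Y * Z - X * Y"
    unfolding AB BC using D by (simp add: field_simps)
  moreover have "2 * (D / 4) * (A * C - A * B) = X * Z - X * Y"
    unfolding AB AC using D by (simp add: field_simps)
  moreover have "2 * 2 * (D / 4) * (A * B) = 1 + X * Y - X * Z - Y * Z"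
    unfolding AB using D by (simp add: field_simps)
  ultimately show ?thesis
    unfolding dual_params_def P P' Let_def grc_params.simps norm by simp
qed

subsection \<open>Bonds\<close>

definition hseg :: "real \<Rightarrow> real \<Rightarrow> (real \<times> real) set" where
  "hseg p q = closed_segment (p, q) (p + 1, q)"

definition vseg :: "real \<Rightarrow> real \<Rightarrow> (real \<times> real) set" where
  "vseg p q = closed_segment (p, q) (p, q + 1)"

lemma hseg_eq: "hseg p q = {p..p + 1} \<times> {q}"
proof -
  have "(x, y) \<in> hseg p q \<longleftrightarrow> (x, y) \<in> {p..p + 1} \<times> {q}" for x y
    unfolding hseg_def closed_segment_def
    by (auto simp: algebra_simps intro!: exI[of _ "x - p"])
  then show ?thesis by auto
qed

lemma vseg_eq: "vseg p q = {p} \<times> {q..q + 1}"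
proof -
  have "(x, y) \<in> vseg p q \<longleftrightarrow> (x, y) \<in> {p} \<times> {q..q + 1}" for x y
    unfolding vseg_def closed_segment_def
    by (auto simp: algebra_simps intro!: exI[of _ "y - q"])
  then show ?thesis by auto
qed

text \<open>A closed segment, as a point set, determines its unordered pair of endpoints.\<close>

lemma bond_endpoints_closed_segment: "bond_endpoints (closed_segment x y) = {x, y}"
proof -
  have "z \<in> bond_endpoints (closed_segment x y) \<longleftrightarrow> z = x \<or> z = y" for z
    unfolding bond_endpoints_def mem_Collect_eq closed_segment_eq doubleton_eq_iff by blast
  then show ?thesis by blast
qed

text \<open>Two integer squares with sum 1 are each at most 1, which leaves finitely many cases.
  Hence Euclidean distance 1 between lattice points means one step along an axis.\<close>

lemma unit_Ints_pair_cases: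
  fixes u v :: real
  assumes "u \<in> \<int>" "v \<in> \<int>" "u\<^sup>2 + v\<^sup>2 = 1"
  shows "(u = 1 \<or> u = -1) \<and> v = 0 \<or> u = 0 \<and> (v = 1 \<or> v = -1)"
proof -
  obtain i j where ij: "u = of_int i" "v = of_int j"
    using assms by (elim Ints_cases)
  have "(of_int (i\<^sup>2 + j\<^sup>2) :: real) = of_int 1"
    using assms(3) by (simp add: ij)
  then have eq: "i\<^sup>2 + j\<^sup>2 = 1"
    by (simp only: of_int_eq_iff)
  then have "i\<^sup>2 \<le> 1" "j\<^sup>2 \<le> 1"
    using zero_le_power2[of i] zero_le_power2[of j] by linarith+
  then have "\<bar>i\<bar> \<le> 1" "\<bar>j\<bar> \<le> 1"
    using abs_le_square_iff[of i 1] abs_le_square_iff[of j 1] by simp_all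
  then have "i = -1 \<or> i = 0 \<or> i = 1" "j = -1 \<or> j = 0 \<or> j = 1"
    by linarith+
  with eq show ?thesis
    unfolding ij by auto
qed

text \<open>Differences of points of \<open>L\<close> are integers whatever the shift
  \<open>c\<close>, so one argument serves the lattice (\<open>c = 0\<close>) and its dual
  (\<open>c = 1/2\<close>). Of the four possible steps, the two backward ones are reversed to start
  at the left or lower end.\<close>

lemma lattice_bonds_translate:
  fixes c :: real
  defines "L \<equiv> {(p, q). p - c \<in> \<int> \<and> q - c \<in> \<int>}"
  shows "lattice_bonds L = {hseg p q | p q. (p, q) \<in> L} \<union> {vseg p q | p q. (p, q) \<in> L}"
proof (intro equalityI subsetI)
  fix b assume "b \<in> lattice_bonds L"
  then obtain p q p' q' where b: "b = closed_segment (p, q) (p', q')"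
    and L: "(p, q) \<in> L" "(p', q') \<in> L" and d: "dist (p, q) (p', q') = 1"
    unfolding lattice_bonds_def by force
  have "(p' - c) - (p - c) \<in> \<int>" "(q' - c) - (q - c) \<in> \<int>"
    using L unfolding L_def by (blast intro: Ints_diff)+
  then have "p' - p \<in> \<int>" "q' - q \<in> \<int>"
    by simp_all
  moreover have "(p' - p)\<^sup>2 + (q' - q)\<^sup>2 = 1"
    using d by (simp add: dist_Pair_Pair dist_real_def power2_commute)
  ultimately consider "p' = p + 1" "q' = q" | "p = p' + 1" "q' = q"
    | "p' = p" "q' = q + 1" | "p' = p" "q = q' + 1"
    using unit_Ints_pair_cases[of "p' - p" "q' - q"] by fastforce
  then show "b \<in> {hseg p q | p q. (p, q) \<in> L} \<union> {vseg p q | p q. (p, q) \<in> L}"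
    by cases (use L in \<open>auto simp: b hseg_def vseg_def closed_segment_commute\<close>)
next
  fix b assume "b \<in> {hseg p q | p q. (p, q) \<in> L} \<union> {vseg p q | p q. (p, q) \<in> L}"
  then obtain p q where L: "(p, q) \<in> L" and b: "b = hseg p q \<or> b = vseg p q"
    by blast
  have "(p + 1 - c) \<in> \<int>" "(q + 1 - c) \<in> \<int>"
    using L Ints_add[OF _ Ints_1, of "p - c"] Ints_add[OF _ Ints_1, of "q - c"]
    unfolding L_def by (auto simp: algebra_simps)
  then have "(p + 1, q) \<in> L" "(p, q + 1) \<in> L"
    using L by (auto simp: L_def)
  moreover have "dist (p, q) (p + 1, q) = 1" "dist (p, q) (p, q + 1) = 1"
    by (simp_all add: dist_Pair_Pair dist_real_def)
  ultimately show "b \<in> lattice_bonds L"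
    using L b unfolding lattice_bonds_def hseg_def vseg_def by blast
qed

text \<open>The trivial \<open>- 0\<close> gives the set the shape of \<open>L\<close> in
  \<open>lattice_bonds_translate\<close>.\<close>

lemma square_lattice_eq: "square_lattice = {(p, q). p - 0 \<in> \<int> \<and> q - 0 \<in> \<int>}"
  by (auto simp: square_lattice_def)

lemma dual_lattice_eq: "dual_lattice = {(p, q). p - 1/2 \<in> \<int> \<and> q - 1/2 \<in> \<int>}"
proof -
  have "(p, q) \<in> dual_lattice" if "p - 1/2 \<in> \<int>" "q - 1/2 \<in> \<int>" for p q
    unfolding dual_lattice_def square_lattice_def
    using that by (intro image_eqI[of _ _ "(p - 1/2, q - 1/2)"]) auto
  then show ?thesis
    by (auto simp: dual_lattice_def square_lattice_def)
qed

lemma bonds_eq: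
  "bonds = {hseg p q | p q. (p, q) \<in> square_lattice} \<union> {vseg p q | p q. (p, q) \<in> square_lattice}"
  unfolding bonds_def square_lattice_eq by (rule lattice_bonds_translate)

lemma dual_bonds_eq:
  "dual_bonds = {hseg p q | p q. (p, q) \<in> dual_lattice} \<union> {vseg p q | p q. (p, q) \<in> dual_lattice}"
  unfolding dual_bonds_def dual_lattice_eq by (rule lattice_bonds_translate)

section \<open>The dual bond crossing a given bond\<close>

lemma dual_lattice_half_shift:
  assumes "(i, j) \<in> square_lattice" "\<delta> = 1/2 \<or> \<delta> = -1/2" "\<epsilon> = 1/2 \<or> \<epsilon> = -1/2"
  shows "(i + \<delta>, j + \<epsilon>) \<in> dual_lattice"
proof -
  have "i \<in> \<int>" "j \<in> \<int>"
    using assms(1) by (auto simp: square_lattice_def)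
  moreover have "\<delta> - 1/2 \<in> \<int>" "\<epsilon> - 1/2 \<in> \<int>"
    using assms(2,3) by (elim disjE; hypsubst; simp)+
  ultimately have "i + (\<delta> - 1/2) \<in> \<int>" "j + (\<epsilon> - 1/2) \<in> \<int>"
    by (simp_all only: Ints_add)
  then show ?thesis
    by (simp add: dual_lattice_eq algebra_simps)
qed

lemma half_shift_Ints_between:
  fixes i p :: real
  assumes "i \<in> \<int>" "p - 1/2 \<in> \<int>" "i - 1 \<le> p" "p \<le> i + 1"
  shows "p = i - 1/2 \<or> p = i + 1/2"
proof -
  obtain m n where "i = of_int m" "p - 1/2 = of_int n"
    using assms by (elim Ints_cases)
  \<comment> \<open>Since \<open>p = n + 1/2\<close>, the bounds read
    \<open>m - 3/2 \<le> n \<le> m + 1/2\<close>; rounding outwards to integers makes them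
    strict.\<close>
  moreover from this have "real_of_int (m - 2) < of_int n" "real_of_int n < of_int (m + 1)"
    using assms by simp_all
  then have "n = m - 1 \<or> n = m"
    by linarith
  ultimately show ?thesis by auto
qed

text \<open>A parallel dual bond lies at half-integer height and misses the bond; for a
  perpendicular one, meeting the bond confines each coordinate of its lower end to a unit interval
  between integers, which contains a single half-integer.\<close>

lemma dual_bond_hseg:
  assumes "(i, j) \<in> square_lattice"
  shows "dual_bond (hseg i j) = vseg (i + 1/2) (j - 1/2)"
  unfolding dual_bond_def
proof (rule the_equality)
  have "vseg (i + 1/2) (j - 1/2) \<in> dual_bonds"
    using dual_lattice_half_shift[OF assms, of "1/2" "-1/2"] unfolding dual_bonds_eq by auto
  \<comment> \<open>The crossing point is the common midpoint.\<close>
  moreover have "(i + 1/2, j) \<in> vseg (i + 1/2) (j - 1/2) \<inter> hseg i j"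
    by (simp add: hseg_eq vseg_eq)
  ultimately show "vseg (i + 1/2) (j - 1/2) \<in> dual_bonds \<and> vseg (i + 1/2) (j - 1/2) \<inter> hseg i j \<noteq> {}"
    by blast
next
  have ij: "i \<in> \<int>" "j \<in> \<int>"
    using assms by (auto simp: square_lattice_def)
  fix e assume e: "e \<in> dual_bonds \<and> e \<inter> hseg i j \<noteq> {}"
  then obtain p q where pq: "p - 1/2 \<in> \<int>" "q - 1/2 \<in> \<int>" and "e = hseg p q \<or> e = vseg p q"
    unfolding dual_bonds_eq dual_lattice_eq by blast
  then consider "e = hseg p q" | "e = vseg p q" by blast
  then show "e = vseg (i + 1/2) (j - 1/2)"
  proof cases
    case 1
    with e have "q = j" by (auto simp: hseg_eq)
    \<comment> \<open>A common point would give \<open>j = j - 1/2\<close> or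
      \<open>j = j + 1/2\<close>.\<close>
    then show ?thesis
      using half_shift_Ints_between[OF ij(2) pq(2)] by simp
  next
    case 2
    with e have "i \<le> p" "p \<le> i + 1" "q \<le> j" "j \<le> q + 1"
      by (auto simp: hseg_eq vseg_eq)
    \<comment> \<open>The bounds \<open>i \<le> p\<close> and \<open>q \<le> j\<close> rule out the
      alternatives \<open>i - 1/2\<close> and \<open>j + 1/2\<close>.\<close>
    then show ?thesis
      using 2 half_shift_Ints_between[OF ij(1) pq(1)] half_shift_Ints_between[OF ij(2) pq(2)]
      by auto
  qed
qed

text \<open>The argument of \<open>dual_bond_hseg\<close> with the two coordinates
  exchanged.\<close>

lemma dual_bond_vseg:
  assumes "(i, j) \<in> square_lattice"
  shows "dual_bond (vseg i j) = hseg (i - 1/2) (j + 1/2)"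
  unfolding dual_bond_def
proof (rule the_equality)
  have "hseg (i - 1/2) (j + 1/2) \<in> dual_bonds"
    using dual_lattice_half_shift[OF assms, of "-1/2" "1/2"] unfolding dual_bonds_eq by auto
  moreover have "(i, j + 1/2) \<in> hseg (i - 1/2) (j + 1/2) \<inter> vseg i j"
    by (simp add: hseg_eq vseg_eq)
  ultimately show "hseg (i - 1/2) (j + 1/2) \<in> dual_bonds \<and> hseg (i - 1/2) (j + 1/2) \<inter> vseg i j \<noteq> {}"
    by blast
next
  have ij: "i \<in> \<int>" "j \<in> \<int>"
    using assms by (auto simp: square_lattice_def)
  fix e assume e: "e \<in> dual_bonds \<and> e \<inter> vseg i j \<noteq> {}"
  then obtain p q where pq: "p - 1/2 \<in> \<int>" "q - 1/2 \<in> \<int>" and "e = hseg p q \<or> e = vseg p q"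
    unfolding dual_bonds_eq dual_lattice_eq by blast
  then consider "e = vseg p q" | "e = hseg p q" by blast
  then show "e = hseg (i - 1/2) (j + 1/2)"
  proof cases
    case 1
    with e have "p = i" by (auto simp: vseg_eq)
    then show ?thesis
      using half_shift_Ints_between[OF ij(1) pq(1)] by simp
  next
    case 2
    with e have "j \<le> q" "q \<le> j + 1" "p \<le> i" "i \<le> p + 1"
      by (auto simp: hseg_eq vseg_eq)
    then show ?thesis
      using 2 half_shift_Ints_between[OF ij(1) pq(1)] half_shift_Ints_between[OF ij(2) pq(2)]
      by auto
  qed
qed

section \<open>Bonds at a site and sides of its plaquette\<close>

definition site_bonds :: "real \<times> real \<Rightarrow> (real \<times> real) set set" where
  "site_bonds t = (case t of (i, j) \<Rightarrow> {hseg i j, hseg (i - 1) j, vseg i j, vseg i (j - 1)})"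

text \<open>Right, left, top, bottom: the order in which \<open>dual_bond\<close> maps the bonds
  listed in \<open>site_bonds\<close>.\<close>

definition plaquette_sides :: "real \<times> real \<Rightarrow> (real \<times> real) set set" where
  "plaquette_sides t = (case t of (i, j) \<Rightarrow>
     {vseg (i + 1/2) (j - 1/2), vseg (i - 1/2) (j - 1/2),
      hseg (i - 1/2) (j + 1/2), hseg (i - 1/2) (j - 1/2)})"

text \<open>Grouping bonds by site makes duality a local matter; a bond with both ends in \<Lambda>
  merely occurs in two of the sets.\<close>

lemma bonds_plus_eq:
  assumes "\<Lambda> \<subseteq> square_lattice"
  shows "bonds_plus \<Lambda> = (\<Union>t\<in>\<Lambda>. site_bonds t)"
proof (intro equalityI subsetI)
  fix b assume "b \<in> bonds_plus \<Lambda>"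
  then obtain p q where meets: "bond_endpoints b \<inter> \<Lambda> \<noteq> {}" and "b = hseg p q \<or> b = vseg p q"
    unfolding bonds_plus_def bonds_eq by blast
  then consider "b = hseg p q" | "b = vseg p q" by blast
  then show "b \<in> (\<Union>t\<in>\<Lambda>. site_bonds t)"
  proof cases
    case 1
    then have "b \<in> site_bonds (p, q)" "b \<in> site_bonds (p + 1, q)"
      by (simp_all add: site_bonds_def)
    moreover have "(p, q) \<in> \<Lambda> \<or> (p + 1, q) \<in> \<Lambda>"
      using meets by (auto simp: 1 hseg_def bond_endpoints_closed_segment)
    ultimately show ?thesis by blast
  next
    case 2
    then have "b \<in> site_bonds (p, q)" "b \<in> site_bonds (p, q + 1)"
      by (simp_all add: site_bonds_def)
    moreover have "(p, q) \<in> \<Lambda> \<or> (p, q + 1) \<in> \<Lambda>"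
      using meets by (auto simp: 2 vseg_def bond_endpoints_closed_segment)
    ultimately show ?thesis by blast
  qed
next
  fix b assume "b \<in> (\<Union>t\<in>\<Lambda>. site_bonds t)"
  then obtain i j where t: "(i, j) \<in> \<Lambda>" and b: "b \<in> site_bonds (i, j)"
    by auto
  have "i \<in> \<int>" "j \<in> \<int>"
    using t assms by (auto simp: square_lattice_def)
  then have L: "(i, j) \<in> square_lattice" "(i - 1, j) \<in> square_lattice" "(i, j - 1) \<in> square_lattice"
    by (auto simp: square_lattice_def)
  have "b \<in> bonds"
    using b L unfolding bonds_eq site_bonds_def by auto
  moreover have "(i, j) \<in> bond_endpoints b"
    using b by (auto simp: site_bonds_def hseg_def vseg_def bond_endpoints_closed_segment)
  ultimately show "b \<in> bonds_plus \<Lambda>"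
    using t by (auto simp: bonds_plus_def)
qed

lemma dual_bond_image_site_bonds:
  assumes "t \<in> square_lattice"
  shows "dual_bond ` site_bonds t = plaquette_sides t"
proof -
  obtain i j where t: "t = (i, j)" by (cases t)
  have "i \<in> \<int>" "j \<in> \<int>"
    using assms by (auto simp: t square_lattice_def)
  then have "(i, j) \<in> square_lattice" "(i - 1, j) \<in> square_lattice" "(i, j - 1) \<in> square_lattice"
    by (auto simp: square_lattice_def)
  then show ?thesis
    by (simp add: t site_bonds_def plaquette_sides_def dual_bond_hseg dual_bond_vseg)
qed

lemma frontier_dual_plaquette:
  "(x, y) \<in> frontier (dual_plaquette (i, j)) \<longleftrightarrow>
    (i - 1/2 \<le> x \<and> x \<le> i + 1/2 \<and> j - 1/2 \<le> y \<and> y \<le> j + 1/2) \<and>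
    (x = i - 1/2 \<or> x = i + 1/2 \<or> y = j - 1/2 \<or> y = j + 1/2)"
  unfolding dual_plaquette_def frontier_cbox
  by (auto simp: cbox_Pair_eq box_def Basis_prod_def)

text \<open>A dual bond is as long as a side of the plaquette, so inside the boundary it must fill a
  whole side.\<close>

lemma dual_bonds_in_frontier:
  assumes "t \<in> square_lattice"
  shows "{e \<in> dual_bonds. e \<subseteq> frontier (dual_plaquette t)} = plaquette_sides t"
proof (intro equalityI subsetI)
  obtain i j where t: "t = (i, j)" by (cases t)
  {
    fix e assume "e \<in> {e \<in> dual_bonds. e \<subseteq> frontier (dual_plaquette t)}"
    then obtain p q where sub: "e \<subseteq> frontier (dual_plaquette (i, j))"
      and "e = hseg p q \<or> e = vseg p q"
      unfolding dual_bonds_eq t by blast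
    then consider "e = hseg p q" | "e = vseg p q" by blast
    then show "e \<in> plaquette_sides t"
    proof cases
      case 1
      then have "(p, q) \<in> e" "(p + 1, q) \<in> e" "(p + 1/2, q) \<in> e"
        by (auto simp: hseg_eq)
      \<comment> \<open>The endpoints force \<open>p = i - 1/2\<close>. They would still allow a
        chord through the interior; the midpoint, with first coordinate \<open>i\<close>, excludes
        it and puts \<open>q\<close> at an extreme height.\<close>
      from this[THEN subsetD[OF sub]] have "p = i - 1/2" "q = j - 1/2 \<or> q = j + 1/2"
        unfolding frontier_dual_plaquette by auto
      with 1 show ?thesis
        by (auto simp: t plaquette_sides_def)
    next
      case 2
      then have "(p, q) \<in> e" "(p, q + 1) \<in> e" "(p, q + 1/2) \<in> e"
        by (auto simp: vseg_eq)
      from this[THEN subsetD[OF sub]] have "q = j - 1/2" "p = i - 1/2 \<or> p = i + 1/2"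
        unfolding frontier_dual_plaquette by auto
      with 2 show ?thesis
        by (auto simp: t plaquette_sides_def)
    qed
  next
    fix e assume e: "e \<in> plaquette_sides t"
    have "e \<in> dual_bonds"
      using e dual_lattice_half_shift[OF assms[unfolded t], of "1/2" "-1/2"]
        dual_lattice_half_shift[OF assms[unfolded t], of "-1/2" "-1/2"]
        dual_lattice_half_shift[OF assms[unfolded t], of "-1/2" "1/2"]
      unfolding dual_bonds_eq t plaquette_sides_def by auto
    moreover have "e \<subseteq> frontier (dual_plaquette t)"
      using e unfolding t
      by (auto simp: plaquette_sides_def hseg_eq vseg_eq frontier_dual_plaquette)
    ultimately show "e \<in> {e \<in> dual_bonds. e \<subseteq> frontier (dual_plaquette t)}"
      by simp
  }
qed

text \<open>Images commute with unions, so the identity for a single site gives it for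
  \<Lambda>.\<close>

lemma dual_bond_image_bonds_plus:
  assumes "\<Lambda> \<subseteq> square_lattice"
  shows "dual_bond ` bonds_plus \<Lambda> = dual_complex_bonds \<Lambda>"
proof -
  have "dual_bond ` bonds_plus \<Lambda> = (\<Union>t\<in>\<Lambda>. dual_bond ` site_bonds t)"
    unfolding bonds_plus_eq[OF assms] by (rule image_UN)
  also have "\<dots> = (\<Union>t\<in>\<Lambda>. {e \<in> dual_bonds. e \<subseteq> frontier (dual_plaquette t)})"
    by (intro SUP_cong refl)
      (simp only: dual_bond_image_site_bonds dual_bonds_in_frontier subsetD[OF assms])
  also have "\<dots> = dual_complex_bonds \<Lambda>"
    by (auto simp: dual_complex_bonds_def)
  finally show ?thesis .
qed

theorem mainTheorem5:
  fixes \<Lambda> :: "(real \<times> real) set"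
    and J J' :: "real \<times> real \<times> real"
  assumes "\<Lambda> \<subseteq> square_lattice"
    and "bounded \<Lambda>"
    and "lattice_simply_connected \<Lambda>"
    and "J \<in> at_domain"
    and "J' \<in> at_domain"
    and "at_dual J J'"
  shows "dual_grc (at_grc_plus \<Lambda> J) = at_grc_free (dual_complex \<Lambda>) J'
    \<and> dual_bond ` bonds_plus \<Lambda> = complex_bonds (dual_complex \<Lambda>)
    \<and> a_0 (dual_params (at_params J)) = a_0 (at_params J')
    \<and> a_sigma (dual_params (at_params J)) = a_sigma (at_params J')
    \<and> a_tau (dual_params (at_params J)) = a_tau (at_params J')
    \<and> a_sigmatau (dual_params (at_params J)) = a_sigmatau (at_params J')
    \<and> q_sigma (dual_params (at_params J)) = 2 \<and> q_sigma (at_params J') = 2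
    \<and> q_tau (dual_params (at_params J)) = 2 \<and> q_tau (at_params J') = 2"
proof -
  have params: "dual_params (at_params J) = at_params J'"
    using assms(6) by (rule dual_params_at_params)
  have bonds: "dual_bond ` bonds_plus \<Lambda> = complex_bonds (dual_complex \<Lambda>)"
    using dual_bond_image_bonds_plus[OF assms(1)] by (simp add: dual_complex_def)
  have "q_sigma (at_params J') = 2" "q_tau (at_params J') = 2"
    by (cases J'; simp add: Let_def)+
  \<comment> \<open>Both models are built by \<open>grc_free\<close>, so equality of bond sets and
    of parameters makes them equal.\<close>
  then show ?thesis
    using params bonds
    by (simp add: dual_grc_def at_grc_plus_def at_grc_free_def grc_plus_def)
qed

end
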